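(* Let $0<p\le1$ and let $M,M'$ be closed $\mathsf{pPCF}$ terms of type $\sigma$. If $d^p_{\mathrm{obs}}(M,M')=0$ then $M$ and $M'$ are observationally equivalent, i.e. $\mathbb P((C)M\to\underline0)=\mathbb P((C)M'\to\underline0)$ for every closed term $C:\sigma\Rightarrow\mathsf{nat}$.
   Context: **pPCF.** Types $\sigma::=\mathsf{nat}\mid\sigma\Rightarrow\tau$; terms $\underline n$, $\mathsf{succ}(M)$, $\mathsf{pred}(M)$, $x$, $\mathsf{coin}(r)$ ($r\in[0,1]\cap\mathbb Q$), $\mathsf{let}\,x=M\,\mathsf{in}\,N$ ($M:\mathsf{nat}$, $x:\mathsf{nat}$), $\mathsf{if}(M,N,P)$ ($M:\mathsf{nat}$, $N,P:\sigma$), $(M)N$, $\lambda x^\sigma M$, $\mathsf{fix}(M)$ ($M:\sigma\Rightarrow\sigma$), simply typed. $\Omega_\sigma=\mathsf{fix}(\lambda x^\sigma x)$. **Operational semantics.** Stacks $\pi::=\varepsilon\mid\mathsf{arg}(M)\cdot\pi\mid\mathsf{succ}\cdot\pi\mid\mathsf{pred}\cdot\pi\mid\mathsf{if}(N,P)\cdot\pi\mid\mathsf{let}(x,N)\cdot\pi$; states $\langle M,\pi\rangle$ (closed, well-typed, ending in $\mathsf{nat}$). $\mathrm{Eval}(s,\alpha)\in[0,1]$, $\alpha\in\{0,1\}^{<\omega}$, is the least partial function such that $\mathrm{Eval}(\text{lhs},\alpha)=\mathrm{Eval}(\text{rhs},\alpha)$ for each step: $\langle\mathsf{let}\,x=M\,\mathsf{in}\,N,\pi\rangle\to\langle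 M,\mathsf{let}(x,N)\cdot\pi\rangle$, $\langle(M)N,\pi\rangle\to\langle M,\mathsf{arg}(N)\cdot\pi\rangle$, $\langle\mathsf{if}(M,N,P),\pi\rangle\to\langle M,\mathsf{if}(N,P)\cdot\pi\rangle$, $\langle\mathsf{fix}(M),\pi\rangle\to\langle M,\mathsf{arg}(\mathsf{fix}(M))\cdot\pi\rangle$, $\langle\mathsf{succ}(M),\pi\rangle\to\langle M,\mathsf{succ}\cdot\pi\rangle$, $\langle\mathsf{pred}(M),\pi\rangle\to\langle M,\mathsf{pred}\cdot\pi\rangle$, $\langle\underline n,\mathsf{let}(x,N)\cdot\pi\rangle\to\langle N[\underline n/x],\pi\rangle$, $\langle\lambda x^\sigma M,\mathsf{arg}(N)\cdot\pi\rangle\to\langle M[N/x],\pi\rangle$, $\langle\underline0,\mathsf{if}(N,P)\cdot\pi\rangle\to\langle N,\pi\rangle$, $\langle\underline{n+1},\mathsf{if}(N,P)\cdot\pi\rangle\to\langle P,\pi\rangle$, $\langle\underline n,\mathsf{succ}\cdot\pi\rangle\to\langle\underline{n+1},\pi\rangle$, $\langle\underline0,\mathsf{pred}\cdot\pi\rangle\to\langle\underline0,\pi\rangle$, $\langle\underline{n+1},\mathsf{pred}\cdot\pi\rangle\to\langle\underline n,\pi\rangle$; moreover $\mathrm{Eval}(\langle\mathsf{coin}(r),\pi\rangle,i\alpha)=\mathrm{Eval}(\langle\underline i,\pi\rangle,\alpha)\cdot\rho_i(r)$ with $\rho_0(r)=r$, $\rho_1(r)=1-r$, and $\mathrm{Eval}(\langle\underline0,\varepsilon\rangle,\langle\rangle)=1$.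 For closed $M:\mathsf{nat}$, $\mathbb P(M\to\underline0)=\sum\{\mathrm{Eval}(\langle M,\varepsilon\rangle,\alpha)\mid\alpha\text{ where defined}\}$. **Tamed distance.** For closed $C:\sigma\Rightarrow\mathsf{nat}$, $C_p=\lambda z^\sigma(C)\,\mathsf{if}(\mathsf{coin}(p),z,\Omega_\sigma)$, and $d^p_{\mathrm{obs}}(M,M')=\sup_C|\mathbb P((C_p)M\to\underline0)-\mathbb P((C_p)M'\to\underline0)|$ over closed $C:\sigma\Rightarrow\mathsf{nat}$. *)

theory Defs
  imports "HOL-Analysis.Infinite_Sum"
begin

datatype ty = TNat | TFun ty ty (infixr "\<rightarrow>" 70)

text \<open>
  Terms are in de Bruijn notation: \<open>Lam \<sigma> M\<close> binds index 0 in \<open>M\<close>, and \<open>Letin M N\<close>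
  (let x = M in N) binds index 0 in \<open>N\<close>. The parameter of a coin has to lie in the
  rational unit interval; this is imposed by the typing rule for \<open>Coin\<close>.
\<close>

datatype tm =
    Num nat
  | Succ tm
  | Pred tm
  | Var nat
  | Coin rat
  | Letin tm tm
  | Ifz tm tm tm
  | App tm tm
  | Lam ty tm
  | Fix tm

inductive typing :: "ty list \<Rightarrow> tm \<Rightarrow> ty \<Rightarrow> bool" ("_ \<turnstile> _ : _" [50, 50, 50] 50) where
  ty_Num: "\<Gamma> \<turnstile> Num n : TNat"
| ty_Succ: "\<Gamma> \<turnstile> M : TNat \<Longrightarrow> \<Gamma> \<turnstile> Succ M : TNat"
| ty_Pred: "\<Gamma> \<turnstile> M : TNat \<Longrightarrow> \<Gamma> \<turnstile> Pred M : TNat"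
| ty_Var: "i < length \<Gamma> \<Longrightarrow> \<Gamma> \<turnstile> Var i : \<Gamma> ! i"
| ty_Coin: "0 \<le> r \<Longrightarrow> r \<le> 1 \<Longrightarrow> \<Gamma> \<turnstile> Coin r : TNat"
| ty_Letin: "\<Gamma> \<turnstile> M : TNat \<Longrightarrow> TNat # \<Gamma> \<turnstile> N : \<sigma> \<Longrightarrow> \<Gamma> \<turnstile> Letin M N : \<sigma>"
| ty_Ifz: "\<Gamma> \<turnstile> M : TNat \<Longrightarrow> \<Gamma> \<turnstile> N : \<sigma> \<Longrightarrow> \<Gamma> \<turnstile> P : \<sigma> \<Longrightarrow> \<Gamma> \<turnstile> Ifz M N P : \<sigma>"
| ty_App: "\<Gamma> \<turnstile> M : \<sigma> \<rightarrow> \<tau> \<Longrightarrow> \<Gamma> \<turnstile> N : \<sigma> \<Longrightarrow> \<Gamma> \<turnstile> App M N : \<tau>"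
| ty_Lam: "\<sigma> # \<Gamma> \<turnstile> M : \<tau> \<Longrightarrow> \<Gamma> \<turnstile> Lam \<sigma> M : \<sigma> \<rightarrow> \<tau>"
| ty_Fix: "\<Gamma> \<turnstile> M : \<sigma> \<rightarrow> \<sigma> \<Longrightarrow> \<Gamma> \<turnstile> Fix M : \<sigma>"

definition closed_tms :: "ty \<Rightarrow> tm set" where
  "closed_tms \<sigma> = {M. [] \<turnstile> M : \<sigma>}"

primrec lift :: "nat \<Rightarrow> tm \<Rightarrow> tm" where
  "lift k (Num n) = Num n"
| "lift k (Succ M) = Succ (lift k M)"
| "lift k (Pred M) = Pred (lift k M)"
| "lift k (Var i) = (if i < k then Var i else Var (Suc i))"
| "lift k (Coin r) = Coin r"
| "lift k (Letin M N) = Letin (lift k M) (lift (Suc k) N)"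
| "lift k (Ifz M N P) = Ifz (lift k M) (lift k N) (lift k P)"
| "lift k (App M N) = App (lift k M) (lift k N)"
| "lift k (Lam \<sigma> M) = Lam \<sigma> (lift (Suc k) M)"
| "lift k (Fix M) = Fix (lift k M)"

text \<open>
  \<open>subst k N M\<close> is the capture-avoiding substitution of \<open>N\<close> for the variable \<open>k\<close> in \<open>M\<close>;
  that variable disappears, so the indices above \<open>k\<close> are decremented.
\<close>

primrec subst :: "nat \<Rightarrow> tm \<Rightarrow> tm \<Rightarrow> tm" where
  "subst k Q (Num n) = Num n"
| "subst k Q (Succ M) = Succ (subst k Q M)"
| "subst k Q (Pred M) = Pred (subst k Q M)"
| "subst k Q (Var i) = (if i < k then Var i else if i = k then Q else Var (i - 1))"
| "subst k Q (Coin r) = Coin r"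
| "subst k Q (Letin M N) = Letin (subst k Q M) (subst (Suc k) (lift 0 Q) N)"
| "subst k Q (Ifz M N P) = Ifz (subst k Q M) (subst k Q N) (subst k Q P)"
| "subst k Q (App M N) = App (subst k Q M) (subst k Q N)"
| "subst k Q (Lam \<sigma> M) = Lam \<sigma> (subst (Suc k) (lift 0 Q) M)"
| "subst k Q (Fix M) = Fix (subst k Q M)"

definition Omega :: "ty \<Rightarrow> tm" where
  "Omega \<sigma> = Fix (Lam \<sigma> (Var 0))"

datatype frame = ArgF tm | SuccF | PredF | IfF tm tm | LetF tm

text \<open>
  A stack is a list of frames with its top at the head. The rules below apply to arbitrary
  raw states; they preserve closedness and typing, so that on the well-typed closed states
  they define exactly the intended evaluation.
\<close>

type_synonym state = "tm \<times> frame list"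

inductive step :: "state \<Rightarrow> state \<Rightarrow> bool" where
  "step (Letin M N, \<pi>) (M, LetF N # \<pi>)"
| "step (App M N, \<pi>) (M, ArgF N # \<pi>)"
| "step (Ifz M N P, \<pi>) (M, IfF N P # \<pi>)"
| "step (Fix M, \<pi>) (M, ArgF (Fix M) # \<pi>)"
| "step (Succ M, \<pi>) (M, SuccF # \<pi>)"
| "step (Pred M, \<pi>) (M, PredF # \<pi>)"
| "step (Num n, LetF N # \<pi>) (subst 0 (Num n) N, \<pi>)"
| "step (Lam \<sigma> M, ArgF N # \<pi>) (subst 0 N M, \<pi>)"
| "step (Num 0, IfF N P # \<pi>) (N, \<pi>)"
| "step (Num (Suc n), IfF N P # \<pi>) (P, \<pi>)"
| "step (Num n, SuccF # \<pi>) (Num (Suc n), \<pi>)"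
| "step (Num 0, PredF # \<pi>) (Num 0, \<pi>)"
| "step (Num (Suc n), PredF # \<pi>) (Num n, \<pi>)"

text \<open>
  \<open>evals s \<alpha> v\<close> is the graph of the least partial function Eval: it says that
  \<open>Eval(s, \<alpha>)\<close> is defined and equal to \<open>v\<close>. In the list \<open>\<alpha>\<close> of coin outcomes,
  \<open>False\<close> stands for 0 and \<open>True\<close> for 1.
\<close>

inductive evals :: "state \<Rightarrow> bool list \<Rightarrow> real \<Rightarrow> bool" where
  evals_done: "evals (Num 0, []) [] 1"
| evals_step: "step s s' \<Longrightarrow> evals s' \<alpha> v \<Longrightarrow> evals s \<alpha> v"
| evals_coin0: "evals (Num 0, \<pi>) \<alpha> v \<Longrightarrow>
    evals (Coin r, \<pi>) (False # \<alpha>) (v * real_of_rat r)"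
| evals_coin1: "evals (Num 1, \<pi>) \<alpha> v \<Longrightarrow>
    evals (Coin r, \<pi>) (True # \<alpha>) (v * (1 - real_of_rat r))"

lemma step_deterministic: "step s s' \<Longrightarrow> step s s'' \<Longrightarrow> s' = s''"
  by (induction rule: step.induct) (erule step.cases, simp_all)+

lemma no_step_Coin: "\<not> step (Coin r, \<pi>) s" and no_step_final: "\<not> step (Num n, []) s"
  by (rule notI, erule step.cases, simp_all)+

lemma evals_deterministic: "evals s \<alpha> v \<Longrightarrow> evals s \<alpha> w \<Longrightarrow> v = w"
proof (induction arbitrary: w rule: evals.induct)
  case evals_done
  then show ?case by (cases rule: evals.cases) (simp_all add: no_step_final)
next
  case (evals_step s s' \<alpha> v)
  from evals_step.prems show ?case
  proof (cases rule: evals.cases)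
    case (evals_step s'')
    then show ?thesis
      using evals_step.IH step_deterministic[OF \<open>step s s'\<close>] by simp
  qed (use \<open>step s s'\<close> in \<open>simp_all add: no_step_Coin no_step_final\<close>)
next
  case (evals_coin0 \<pi> \<alpha> v r)
  from evals_coin0.prems show ?case
    by (cases rule: evals.cases) (auto simp: no_step_Coin dest: evals_coin0.IH)
next
  case (evals_coin1 \<pi> \<alpha> v r)
  from evals_coin1.prems show ?case
    by (cases rule: evals.cases) (auto simp: no_step_Coin simp del: One_nat_def dest: evals_coin1.IH)
qed

definition Eval :: "state \<Rightarrow> bool list \<Rightarrow> real option" where
  "Eval s \<alpha> = (if \<exists>v. evals s \<alpha> v then Some (THE v. evals s \<alpha> v) else None)"

lemma Eval_eq_Some_iff: "Eval s \<alpha> = Some v \<longleftrightarrow> evals s \<alpha> v"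
  unfolding Eval_def by (auto intro: the_equality theI dest: evals_deterministic)

text \<open>
  The probability that \<open>M\<close> reduces to the numeral 0. For a closed \<open>M\<close> of type \<open>TNat\<close> the
  summands are non-negative and, the domain of \<open>Eval (M, [])\<close> being prefix-free, their
  sums over finite sets are at most 1; so the sum exists.
\<close>

definition prob0 :: "tm \<Rightarrow> real" where
  "prob0 M = (\<Sum>\<^sub>\<infinity>\<alpha>\<in>dom (Eval (M, [])). the (Eval (M, []) \<alpha>))"

definition tamed :: "rat \<Rightarrow> ty \<Rightarrow> tm \<Rightarrow> tm" where
  "tamed p \<sigma> C = Lam \<sigma> (App (lift 0 C) (Ifz (Coin p) (Var 0) (Omega \<sigma>)))"

text \<open>
  The supremum below is taken over a non-empty subset of the real unit interval when
  \<open>M\<close> and \<open>M'\<close> are closed terms of type \<open>\<sigma>\<close> and \<open>p\<close> lies in the unit interval.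
\<close>

definition obs_dist :: "rat \<Rightarrow> ty \<Rightarrow> tm \<Rightarrow> tm \<Rightarrow> real" where
  "obs_dist p \<sigma> M M' =
    (SUP C\<in>closed_tms (\<sigma> \<rightarrow> TNat).
      \<bar>prob0 (App (tamed p \<sigma> C) M) - prob0 (App (tamed p \<sigma> C) M')\<bar>)"

definition obs_equiv :: "ty \<Rightarrow> tm \<Rightarrow> tm \<Rightarrow> bool" where
  "obs_equiv \<sigma> M M' \<longleftrightarrow>
    (\<forall>C\<in>closed_tms (\<sigma> \<rightarrow> TNat). prob0 (App C M) = prob0 (App C M'))"

end

theory Submission
  imports Defs
begin

text \<open>
  Sort the converging runs of \<open>App C M\<close> by the number \<open>n\<close> of times the argument is called.
  If every call first has to win a coin of bias \<open>t\<close> and diverges otherwise, the probability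
  of convergence becomes a power series \<open>\<Sum>n. a n * t ^ n\<close>. The context obtained by taming
  \<open>C\<close> with \<open>q\<close> is tested by the distance at the parameter \<open>t = p * q\<close>, so a vanishing distance makes
  the series of \<open>M\<close> and \<open>M'\<close> agree at the points \<open>p / (j + 1)\<close>. These accumulate at 0,
  so the coefficients coincide, and the claim is the case \<open>t = 1\<close>.
\<close>

section \<open>Evaluation as a subprobability weight\<close>

text \<open>Coins and the final state have no step, and steps are deterministic, so only the step
  rule can have produced the evaluation of \<open>s\<close>.\<close>

lemma evals_step_iff: "step s s' \<Longrightarrow> evals s \<alpha> v \<longleftrightarrow> evals s' \<alpha> v"
proof
  assume s: "step s s'" and "evals s \<alpha> v"
  from this(2) show "evals s' \<alpha> v"
    by cases (use s in \<open>auto simp: no_step_Coin no_step_final dest: step_deterministic\<close>)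
qed (rule evals_step)

lemma evals_final_iff: "evals (Num 0, []) \<alpha> v \<longleftrightarrow> \<alpha> = [] \<and> v = 1"
  by (subst evals.simps) (auto simp: no_step_final)

lemma evals_Coin_iff:
  "evals (Coin r, \<pi>) \<alpha> v \<longleftrightarrow>
    (\<exists>\<beta> w. \<alpha> = False # \<beta> \<and> v = w * real_of_rat r \<and> evals (Num 0, \<pi>) \<beta> w) \<or>
    (\<exists>\<beta> w. \<alpha> = True # \<beta> \<and> v = w * (1 - real_of_rat r) \<and> evals (Num 1, \<pi>) \<beta> w)"
  by (subst evals.simps) (auto simp: no_step_Coin simp del: One_nat_def)

section \<open>Coin parameters of terms and states; closed terms\<close>

primrec coins :: "tm \<Rightarrow> rat set" where
  "coins (Num n) = {}"
| "coins (Succ M) = coins M"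
| "coins (Pred M) = coins M"
| "coins (Var i) = {}"
| "coins (Coin r) = {r}"
| "coins (Letin M N) = coins M \<union> coins N"
| "coins (Ifz M N P) = coins M \<union> coins N \<union> coins P"
| "coins (App M N) = coins M \<union> coins N"
| "coins (Lam \<sigma> M) = coins M"
| "coins (Fix M) = coins M"

primrec frame_coins :: "frame \<Rightarrow> rat set" where
  "frame_coins (ArgF M) = coins M"
| "frame_coins SuccF = {}"
| "frame_coins PredF = {}"
| "frame_coins (IfF M N) = coins M \<union> coins N"
| "frame_coins (LetF M) = coins M"

definition state_coins :: "state \<Rightarrow> rat set" where
  "state_coins s = coins (fst s) \<union> \<Union> (frame_coins ` set (snd s))"

lemma coins_lift [simp]: "coins (lift k M) = coins M"
  by (induction M arbitrary: k) auto

lemma coins_subst: "coins (subst k N M) \<subseteq> coins M \<union> coins N"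
proof (induction M arbitrary: k N)
  case (Letin M1 M2)
  show ?case using Letin.IH(1)[of k N] Letin.IH(2)[of "Suc k" "lift 0 N"] by auto
next
  case (Lam \<sigma> M)
  show ?case using Lam.IH[of "Suc k" "lift 0 N"] by auto
qed (simp; blast)+

text \<open>Steps only copy or discard coins. The bounds on probabilities need no more of typing
  than that all coin parameters lie in the unit interval, so this invariant takes the place of
  subject reduction.\<close>

lemma coins_step: "step s s' \<Longrightarrow> state_coins s' \<subseteq> state_coins s"
  by (induction rule: step.induct) (use coins_subst in \<open>fastforce simp: state_coins_def\<close>)+

lemma typing_coins: "\<Gamma> \<turnstile> M : \<sigma> \<Longrightarrow> coins M \<subseteq> {0..1}"
  by (induction rule: typing.induct) auto

text \<open>The free indices of a typed term are below \<open>length \<Gamma>\<close>, so a cut-off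
  \<open>k\<close> beyond them touches none.\<close>

lemma typing_lift_subst:
  "\<Gamma> \<turnstile> M : \<sigma> \<Longrightarrow> length \<Gamma> \<le> k \<Longrightarrow> lift k M = M \<and> subst k N M = M"
  by (induction arbitrary: k N rule: typing.induct) auto

lemma typing_weaken: "\<Gamma> \<turnstile> M : \<sigma> \<Longrightarrow> \<Gamma> @ \<Delta> \<turnstile> M : \<sigma>"
proof (induction rule: typing.induct)
  case (ty_Var i \<Gamma>)
  then have "\<Gamma> ! i = (\<Gamma> @ \<Delta>) ! i" "i < length (\<Gamma> @ \<Delta>)" by (auto simp: nth_append)
  then show ?case by (metis typing.ty_Var)
qed (auto intro: typing.intros)

lemma closed_lift: "[] \<turnstile> M : \<sigma> \<Longrightarrow> lift k M = M"
  and closed_subst: "[] \<turnstile> M : \<sigma> \<Longrightarrow> subst k N M = M"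
  using typing_lift_subst[of "[]" M \<sigma> k] by auto

lemma evals_nonneg: "evals s \<alpha> v \<Longrightarrow> state_coins s \<subseteq> {0..1} \<Longrightarrow> 0 \<le> v"
  by (induction rule: evals.induct)
    (use coins_step in \<open>fastforce simp: state_coins_def\<close>)+

text \<open>Extending \<open>Eval\<close> by 0 gives a total function on coin sequences, which can
  be summed over index sets that do not depend on the state.\<close>

definition weight :: "state \<Rightarrow> bool list \<Rightarrow> real" where
  "weight s \<alpha> = (case Eval s \<alpha> of None \<Rightarrow> 0 | Some v \<Rightarrow> v)"

lemma weight_eqI: "evals s \<alpha> v \<Longrightarrow> weight s \<alpha> = v"
  by (simp add: weight_def flip: Eval_eq_Some_iff)

lemma weight_eq0: "(\<And>v. \<not> evals s \<alpha> v) \<Longrightarrow> weight s \<alpha> = 0"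
  by (simp add: weight_def Eval_def)

lemma weight_cong: "(\<And>v. evals s \<alpha> v \<longleftrightarrow> evals s' \<alpha> v) \<Longrightarrow> weight s \<alpha> = weight s' \<alpha>"
proof -
  assume "\<And>v. evals s \<alpha> v \<longleftrightarrow> evals s' \<alpha> v"
  then have "evals s \<alpha> = evals s' \<alpha>" by (intro ext)
  then show ?thesis by (simp add: weight_def Eval_def)
qed

lemma weight_nonneg: "state_coins s \<subseteq> {0..1} \<Longrightarrow> 0 \<le> weight s \<alpha>"
  by (metis evals_nonneg weight_eqI weight_eq0 order_refl)

lemma weight_Coin:
  "weight (Coin r, \<pi>) [] = 0"
  "weight (Coin r, \<pi>) (False # \<alpha>) = real_of_rat r * weight (Num 0, \<pi>) \<alpha>"
  "weight (Coin r, \<pi>) (True # \<alpha>) = (1 - real_of_rat r) * weight (Num 1, \<pi>) \<alpha>"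
proof -
  show "weight (Coin r, \<pi>) [] = 0"
    by (rule weight_eq0) (simp add: evals_Coin_iff)
  show "weight (Coin r, \<pi>) (False # \<alpha>) = real_of_rat r * weight (Num 0, \<pi>) \<alpha>"
  proof (cases "\<exists>v. evals (Num 0, \<pi>) \<alpha> v")
    case True
    then obtain v where v: "evals (Num 0, \<pi>) \<alpha> v" ..
    show ?thesis using weight_eqI[OF v] weight_eqI[OF evals_coin0[OF v, of r]] by simp
  next
    case False
    then show ?thesis by (simp add: weight_eq0 evals_Coin_iff)
  qed
  show "weight (Coin r, \<pi>) (True # \<alpha>) = (1 - real_of_rat r) * weight (Num 1, \<pi>) \<alpha>"
  proof (cases "\<exists>v. evals (Num 1, \<pi>) \<alpha> v")
    case True
    then obtain v where v: "evals (Num 1, \<pi>) \<alpha> v" ..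
    show ?thesis using weight_eqI[OF v] weight_eqI[OF evals_coin1[OF v, of r]] by simp
  next
    case False
    then show ?thesis by (simp add: weight_eq0 evals_Coin_iff del: One_nat_def)
  qed
qed

lemma lists_Suc_eq:
  "{\<alpha>::bool list. length \<alpha> \<le> Suc n} =
    insert [] (Cons False ` {\<alpha>. length \<alpha> \<le> n} \<union> Cons True ` {\<alpha>. length \<alpha> \<le> n})"
proof (rule set_eqI)
  fix \<alpha> :: "bool list"
  show "\<alpha> \<in> {\<alpha>. length \<alpha> \<le> Suc n} \<longleftrightarrow>
    \<alpha> \<in> insert [] (Cons False ` {\<alpha>. length \<alpha> \<le> n} \<union> Cons True ` {\<alpha>. length \<alpha> \<le> n})"
    by (cases \<alpha>; cases "hd \<alpha>") auto
qed

lemma finite_bool_lists [simp]: "finite {\<alpha>::bool list. length \<alpha> \<le> n}"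
  using finite_lists_length_le[of "UNIV :: bool set" n] by simp

lemma sum_weight_Coin:
  "sum (weight (Coin r, \<pi>)) {\<alpha>. length \<alpha> \<le> Suc n} =
    real_of_rat r * sum (weight (Num 0, \<pi>)) {\<alpha>. length \<alpha> \<le> n} +
    (1 - real_of_rat r) * sum (weight (Num 1, \<pi>)) {\<alpha>. length \<alpha> \<le> n}"
  unfolding lists_Suc_eq
  by (subst sum.insert, simp, force, subst sum.union_disjoint, simp, simp, force)
    (simp add: sum.reindex weight_Coin sum_distrib_left del: One_nat_def)

text \<open>Deterministic steps leave the weight unchanged, and at a coin the sum is a convex
  combination of two sums with a smaller length bound.\<close>

lemma sum_weight_le_1:
  "state_coins s \<subseteq> {0..1} \<Longrightarrow> sum (weight s) {\<alpha>. length \<alpha> \<le> n} \<le> 1"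
proof (induction n arbitrary: s rule: less_induct)
  case (less n)
  have coin_case: "sum (weight (Coin r, \<pi>)) {\<alpha>. length \<alpha> \<le> n} \<le> 1"
    if c: "state_coins (Coin r, \<pi>) \<subseteq> {0..1}" for r \<pi>
  proof (cases n)
    case 0
    then show ?thesis by (simp add: weight_Coin)
  next
    case (Suc m)
    have r: "0 \<le> real_of_rat r" "real_of_rat r \<le> 1" using c by (auto simp: state_coins_def)
    have le: "sum (weight (Num i, \<pi>)) {\<alpha>. length \<alpha> \<le> m} \<le> 1" for i
      by (rule less.IH) (use c Suc in \<open>auto simp: state_coins_def\<close>)
    have "sum (weight (Coin r, \<pi>)) {\<alpha>. length \<alpha> \<le> Suc m} \<le> real_of_rat r * 1 + (1 - real_of_rat r) * 1"
      unfolding sum_weight_Coin by (intro add_mono mult_left_mono le) (use r in auto)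
    then show ?thesis by (simp add: Suc)
  qed
  show ?case
  \<comment> \<open>Any one evaluation of \<open>s\<close> will do: its derivation only guarantees
    that the steps before the next coin come to an end. Without one, all weights are 0.\<close>
  proof (cases "\<exists>\<alpha> v. evals s \<alpha> v")
    case False
    then show ?thesis by (simp add: weight_eq0)
  next
    case True
    then obtain \<alpha> v where "evals s \<alpha> v" by blast
    then show ?thesis using less.prems
    proof (induction rule: evals.induct)
      case evals_done
      have "weight (Num 0, []) = (\<lambda>\<alpha>. if \<alpha> = [] then 1 else 0)"
        by (rule ext) (auto intro!: weight_eqI weight_eq0 simp: evals_final_iff)
      then show ?case by (simp add: sum.delta)
    next
      case (evals_step s s' \<alpha> v)
      have "weight s = weight s'"
        by (rule ext, rule weight_cong) (rule evals_step_iff[OF \<open>step s s'\<close>])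
      then show ?case using evals_step.IH evals_step.prems coins_step[OF \<open>step s s'\<close>] by simp
    next
      case (evals_coin0 \<pi> \<alpha> v r)
      show ?case using coin_case[OF evals_coin0.prems] .
    next
      case (evals_coin1 \<pi> \<alpha> v r)
      show ?case using coin_case[OF evals_coin1.prems] .
    qed
  qed
qed

lemma sum_weight_finite_le_1:
  assumes "state_coins s \<subseteq> {0..1}" and "finite F"
  shows "sum (weight s) F \<le> 1"
proof -
  have "\<exists>n. \<forall>\<alpha>\<in>F. length \<alpha> \<le> n"
    using finite_nat_set_iff_bounded_le[of "length ` F"] \<open>finite F\<close> by auto
  then obtain n where "F \<subseteq> {\<alpha>. length \<alpha> \<le> n}" by auto
  then have "sum (weight s) F \<le> sum (weight s) {\<alpha>. length \<alpha> \<le> n}"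
    by (intro sum_mono2 finite_bool_lists weight_nonneg assms(1)) auto
  then show ?thesis using sum_weight_le_1[OF assms(1), of n] by linarith
qed

lemma weight_summable_on:
  assumes "state_coins s \<subseteq> {0..1}"
  shows "weight s summable_on A"
  by (rule nonneg_bdd_above_summable_on)
    (auto intro!: weight_nonneg sum_weight_finite_le_1 assms bdd_aboveI2[where M = 1])

lemma prob0_eq_infsum: "prob0 M = infsum (weight (M, [])) UNIV"
  unfolding prob0_def
  by (rule infsum_cong_neutral) (auto simp: weight_def split: option.splits)

lemma prob0_nonneg: "coins M \<subseteq> {0..1} \<Longrightarrow> 0 \<le> prob0 M"
  unfolding prob0_eq_infsum by (intro infsum_nonneg weight_nonneg) (simp add: state_coins_def)

lemma prob0_le_1: "coins M \<subseteq> {0..1} \<Longrightarrow> prob0 M \<le> 1"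
  unfolding prob0_eq_infsum
  by (intro infsum_le_finite_sums weight_summable_on sum_weight_finite_le_1)
    (auto simp: state_coins_def)

section \<open>Marked evaluation\<close>

text \<open>
  The out-of-range constant \<open>Coin 2\<close>, which occurs in no typable term and is invariant
  under lifting and substitution, marks the places holding the argument of a context.
\<close>

abbreviation Mark :: tm where "Mark \<equiv> Coin 2"

primrec fill :: "tm \<Rightarrow> tm \<Rightarrow> tm" where
  "fill T (Num n) = Num n"
| "fill T (Succ M) = Succ (fill T M)"
| "fill T (Pred M) = Pred (fill T M)"
| "fill T (Var i) = Var i"
| "fill T (Coin r) = (if r = 2 then T else Coin r)"
| "fill T (Letin M N) = Letin (fill T M) (fill T N)"
| "fill T (Ifz M N P) = Ifz (fill T M) (fill T N) (fill T P)"
| "fill T (App M N) = App (fill T M) (fill T N)"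
| "fill T (Lam \<sigma> M) = Lam \<sigma> (fill T M)"
| "fill T (Fix M) = Fix (fill T M)"

primrec fill_frame :: "tm \<Rightarrow> frame \<Rightarrow> frame" where
  "fill_frame T (ArgF M) = ArgF (fill T M)"
| "fill_frame T SuccF = SuccF"
| "fill_frame T PredF = PredF"
| "fill_frame T (IfF M N) = IfF (fill T M) (fill T N)"
| "fill_frame T (LetF M) = LetF (fill T M)"

definition fill_state :: "tm \<Rightarrow> state \<Rightarrow> state" where
  "fill_state T s = (fill T (fst s), map (fill_frame T) (snd s))"

lemma fill_state_Pair [simp]: "fill_state T (M, \<pi>) = (fill T M, map (fill_frame T) \<pi>)"
  by (simp add: fill_state_def)

lemma fill_trivial: "2 \<notin> coins M \<Longrightarrow> fill T M = M"
  by (induction M) auto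

lemma fill_lift:
  assumes "\<And>k. lift k T = T"
  shows "fill T (lift k M) = lift k (fill T M)"
  by (induction M arbitrary: k) (auto simp: assms)

lemma fill_subst:
  assumes "\<And>k. lift k T = T" and "\<And>k N. subst k N T = T"
  shows "fill T (subst k N M) = subst k (fill T N) (fill T M)"
  by (induction M arbitrary: k N) (auto simp: assms fill_lift)

lemma step_fill:
  assumes "\<And>k. lift k T = T" and "\<And>k N. subst k N T = T"
  shows "step s s' \<Longrightarrow> step (fill_state T s) (fill_state T s')"
  by (induction rule: step.induct) (auto simp: fill_subst[OF assms] intro: step.intros)

lemma step_head_Num:
  "\<exists>s. step (Num n, f # \<pi>) s" if "\<And>N. f \<noteq> ArgF N"
  using that by (cases f; cases n) (auto intro: step.intros)

text \<open>Filling keeps the head constructor of every term other than \<open>Mark\<close> and the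
  kind of every frame, so the rule that applies to the filled state already matches
  \<open>s\<close>.\<close>

lemma step_unfill:
  assumes "step (fill_state T s) s'" and "fst s \<noteq> Mark"
  shows "\<exists>s''. step s s''"
proof -
  obtain H \<pi> where s: "s = (H, \<pi>)" by (cases s)
  show ?thesis
  proof (cases H)
    case (Num n)
    with assms(1) s obtain f \<pi>' where \<pi>: "\<pi> = f # \<pi>'"
      by (cases \<pi>) (auto simp: no_step_final)
    have "f \<noteq> ArgF N" for N
      using assms(1) by (auto simp: s Num \<pi> elim: step.cases)
    then show ?thesis using step_head_Num s Num \<pi> by simp
  next
    case (Lam \<sigma> N)
    with assms(1) show ?thesis
      by (cases \<pi>; cases "hd \<pi>") (auto simp: s elim: step.cases intro: step.intros)
  qed (use assms s in \<open>auto simp: no_step_Coin elim: step.cases intro: step.intros\<close>)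
qed

text \<open>
  The trace of a marked evaluation records the coin outcomes as \<open>Some b\<close> and each call of
  the argument as \<open>None\<close>.
\<close>

inductive mevals :: "tm \<Rightarrow> state \<Rightarrow> bool option list \<Rightarrow> real \<Rightarrow> bool" for M where
  mevals_done: "mevals M (Num 0, []) [] 1"
| mevals_step: "step s s' \<Longrightarrow> mevals M s' \<tau> v \<Longrightarrow> mevals M s \<tau> v"
| mevals_coin0: "r \<noteq> 2 \<Longrightarrow> mevals M (Num 0, \<pi>) \<tau> v \<Longrightarrow>
    mevals M (Coin r, \<pi>) (Some False # \<tau>) (v * real_of_rat r)"
| mevals_coin1: "r \<noteq> 2 \<Longrightarrow> mevals M (Num 1, \<pi>) \<tau> v \<Longrightarrow>
    mevals M (Coin r, \<pi>) (Some True # \<tau>) (v * (1 - real_of_rat r))"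
| mevals_mark: "mevals M (M, \<pi>) \<tau> v \<Longrightarrow> mevals M (Mark, \<pi>) (None # \<tau>) v"

lemma mevals_step_iff: "step s s' \<Longrightarrow> mevals M s \<tau> v \<longleftrightarrow> mevals M s' \<tau> v"
proof
  assume s: "step s s'" and "mevals M s \<tau> v"
  from this(2) show "mevals M s' \<tau> v"
    by cases (use s in \<open>auto simp: no_step_Coin no_step_final dest: step_deterministic\<close>)
qed (rule mevals_step)

lemma mevals_final_iff: "mevals M (Num 0, []) \<tau> v \<longleftrightarrow> \<tau> = [] \<and> v = 1"
  by (subst mevals.simps) (auto simp: no_step_final)

lemma mevals_Coin_iff:
  "r \<noteq> 2 \<Longrightarrow> mevals M (Coin r, \<pi>) \<tau> v \<longleftrightarrow>
    (\<exists>\<tau>' w. \<tau> = Some False # \<tau>' \<and> v = w * real_of_rat r \<and> mevals M (Num 0, \<pi>) \<tau>' w) \<or>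
    (\<exists>\<tau>' w. \<tau> = Some True # \<tau>' \<and> v = w * (1 - real_of_rat r) \<and> mevals M (Num 1, \<pi>) \<tau>' w)"
  by (subst mevals.simps) (auto simp: no_step_Coin simp del: One_nat_def)

lemma mevals_Mark_iff:
  "mevals M (Mark, \<pi>) \<tau> v \<longleftrightarrow> (\<exists>\<tau>'. \<tau> = None # \<tau>' \<and> mevals M (M, \<pi>) \<tau>' v)"
  by (subst mevals.simps) (auto simp: no_step_Coin)

text \<open>Turns a trace into the coin sequence of the filled state: each call stands for the
  outcomes \<open>w\<close> spent before the argument itself starts.\<close>

fun expand :: "bool list \<Rightarrow> bool option list \<Rightarrow> bool list" where
  "expand w [] = []"
| "expand w (None # \<tau>) = w @ expand w \<tau>"
| "expand w (Some b # \<tau>) = b # expand w \<tau>"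

abbreviation calls :: "bool option list \<Rightarrow> nat" where "calls \<tau> \<equiv> count_list \<tau> None"

lemma expand_append [simp]: "expand w (\<tau> @ \<tau>') = expand w \<tau> @ expand w \<tau>'"
  by (induction w \<tau> rule: expand.induct) auto

lemma expand_Some [simp]: "expand w (map Some u) = u"
  by (induction u) auto

text \<open>The state decides whether the next entry is a coin or a call, so a trace can be read
  back from its expansion, and its value with it.\<close>

lemma mevals_inj:
  "mevals M s \<tau> v \<Longrightarrow> mevals M s \<tau>' v' \<Longrightarrow> expand w \<tau> = expand w \<tau>' \<Longrightarrow> \<tau> = \<tau>' \<and> v = v'"
proof (induction arbitrary: \<tau>' v' rule: mevals.induct)
  case mevals_done
  then show ?case by (simp add: mevals_final_iff)
next
  case (mevals_step s s' \<tau> v)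
  then show ?case using mevals_step_iff by blast
next
  case (mevals_coin0 r \<pi> \<tau> v)
  from mevals_coin0.prems obtain \<tau>'' u where
    "\<tau>' = Some False # \<tau>''" "v' = u * real_of_rat r" "mevals M (Num 0, \<pi>) \<tau>'' u"
    unfolding mevals_Coin_iff[OF mevals_coin0.hyps(1)] by auto
  with mevals_coin0.IH[of \<tau>'' u] mevals_coin0.prems(2) show ?case by simp
next
  case (mevals_coin1 r \<pi> \<tau> v)
  from mevals_coin1.prems obtain \<tau>'' u where
    "\<tau>' = Some True # \<tau>''" "v' = u * (1 - real_of_rat r)" "mevals M (Num 1, \<pi>) \<tau>'' u"
    unfolding mevals_Coin_iff[OF mevals_coin1.hyps(1)] by auto
  with mevals_coin1.IH[of \<tau>'' u] mevals_coin1.prems(2) show ?case by simp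
next
  case (mevals_mark \<pi> \<tau> v)
  from mevals_mark.prems obtain \<tau>'' where "\<tau>' = None # \<tau>''" "mevals M (M, \<pi>) \<tau>'' v'"
    unfolding mevals_Mark_iff by auto
  with mevals_mark.IH[of \<tau>'' v'] mevals_mark.prems(2) show ?case by simp
qed

definition runs :: "tm \<Rightarrow> state \<Rightarrow> (bool option list \<times> real) set" where
  "runs M s = {(\<tau>, v). mevals M s \<tau> v}"

text \<open>
  A term \<open>T\<close> that behaves as the argument \<open>M\<close> after the coin outcomes \<open>w\<close>, which have
  probability \<open>c\<close>, and diverges after all others. The backward condition is on marked
  evaluations because a marked state with head \<open>Mark\<close> fills to the same state as one with
  head \<open>T\<close>, to which the induction over evaluations applies.
\<close>

locale thunk =
  fixes M T :: tm and w :: "bool list" and c :: real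
  assumes lift_T: "lift k T = T"
    and subst_T: "subst k N T = T"
    and no_mark_M: "2 \<notin> coins M"
    and no_mark_T: "2 \<notin> coins T"
    and thunk_forward: "evals (M, \<pi>) \<alpha> v \<Longrightarrow> evals (T, \<pi>) (w @ \<alpha>) (v * c)"
    and thunk_backward: "mevals M (T, \<pi>) \<tau> v \<Longrightarrow>
      \<exists>\<tau>' v'. \<tau> = map Some w @ \<tau>' \<and> v = v' * c \<and> mevals M (M, \<pi>) \<tau>' v'"
begin

text \<open>Forward simulation: each call costs the outcomes \<open>w\<close>, hence a factor
  \<open>c\<close>.\<close>

lemma evals_fill: "mevals M s \<tau> v \<Longrightarrow> evals (fill_state T s) (expand w \<tau>) (v * c ^ calls \<tau>)"
proof (induction rule: mevals.induct)
  case mevals_done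
  then show ?case by (simp add: evals_done)
next
  case (mevals_step s s' \<tau> v)
  then show ?case by (blast intro: evals_step step_fill lift_T subst_T)
next
  case (mevals_coin0 r \<pi> \<tau> v)
  then have "evals (Num 0, map (fill_frame T) \<pi>) (expand w \<tau>) (v * c ^ calls \<tau>)" by simp
  from evals_coin0[OF this, of r] show ?case using mevals_coin0.hyps by (simp add: mult_ac)
next
  case (mevals_coin1 r \<pi> \<tau> v)
  then have "evals (Num 1, map (fill_frame T) \<pi>) (expand w \<tau>) (v * c ^ calls \<tau>)" by simp
  from evals_coin1[OF this, of r] show ?case using mevals_coin1.hyps by (simp add: mult_ac)
next
  case (mevals_mark \<pi> \<tau> v)
  then have "evals (M, map (fill_frame T) \<pi>) (expand w \<tau>) (v * c ^ calls \<tau>)"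
    by (simp add: fill_trivial no_mark_M)
  from thunk_forward[OF this] show ?case by (simp add: mult_ac)
qed

text \<open>Backward simulation, by induction on the evaluation of the filled state, for all marked
  states that fill to it.\<close>

lemma mevals_of_evals_fill:
  assumes "evals t \<beta> u" and "t = fill_state T s"
  shows "\<exists>\<tau> v. mevals M s \<tau> v \<and> \<beta> = expand w \<tau>"
  using assms
proof (induction arbitrary: s rule: evals.induct)
  \<comment> \<open>A state with head \<open>Mark\<close> is exchanged for the one with head
    \<open>T\<close>, which fills to the same state and whose head is not \<open>Mark\<close>. Then
    \<open>thunk_backward\<close> strips \<open>w\<close> off the trace and a call is put in its
    place.\<close>
  have mark: "\<exists>\<tau> v. mevals M s \<tau> v \<and> \<beta> = expand w \<tau>"
    if nonmark: "\<And>s. t = fill_state T s \<Longrightarrow> fst s \<noteq> Mark \<Longrightarrow>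
        \<exists>\<tau> v. mevals M s \<tau> v \<and> \<beta> = expand w \<tau>"
      and t: "t = fill_state T s" for t s \<beta>
  proof (cases "fst s = Mark")
    case True
    then obtain \<pi> where s: "s = (Mark, \<pi>)" by (cases s) auto
    have "t = fill_state T (T, \<pi>)" using t s by (simp add: fill_trivial no_mark_T)
    then obtain \<tau> v where \<tau>: "mevals M (T, \<pi>) \<tau> v" "\<beta> = expand w \<tau>"
      using nonmark[of "(T, \<pi>)"] no_mark_T by fastforce
    then obtain \<tau>' v' where \<tau>': "\<tau> = map Some w @ \<tau>'" "mevals M (M, \<pi>) \<tau>' v'"
      using thunk_backward by blast
    have "\<beta> = expand w (None # \<tau>')" using \<tau>(2) \<tau>'(1) by simp
    then show ?thesis using mevals_mark[OF \<tau>'(2)] s by blast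
  qed (use nonmark t in blast)
  {
    case evals_done
    show ?case
    proof (rule mark[OF _ evals_done])
      fix s assume "(Num 0, []) = fill_state T s" "fst s \<noteq> Mark"
      then have "s = (Num 0, [])" by (cases s; cases "fst s") (auto split: if_splits)
      then show "\<exists>\<tau> v. mevals M s \<tau> v \<and> [] = expand w \<tau>"
        using mevals_done expand.simps(1) by metis
    qed
  next
    case (evals_step t t' \<beta> u)
    show ?case
    proof (rule mark[OF _ evals_step.prems])
      fix s assume t: "t = fill_state T s" and "fst s \<noteq> Mark"
      then obtain s' where s': "step s s'" using step_unfill evals_step.hyps(1) by blast
      have "t' = fill_state T s'"
        using step_deterministic[OF evals_step.hyps(1)] step_fill[OF lift_T subst_T s'] t by simp
      then show "\<exists>\<tau> v. mevals M s \<tau> v \<and> \<beta> = expand w \<tau>"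
        using evals_step.IH mevals_step[OF s'] by blast
    qed
  next
    case (evals_coin0 \<pi> \<beta> u r)
    show ?case
    proof (rule mark[OF _ evals_coin0.prems])
      fix s assume "(Coin r, \<pi>) = fill_state T s" "fst s \<noteq> Mark"
      then obtain \<pi>' where s: "s = (Coin r, \<pi>')" "\<pi> = map (fill_frame T) \<pi>'" "r \<noteq> 2"
        by (cases s; cases "fst s") (auto split: if_splits)
      then obtain \<tau> v where \<tau>: "mevals M (Num 0, \<pi>') \<tau> v" "\<beta> = expand w \<tau>"
        using evals_coin0.IH[of "(Num 0, \<pi>')"] by auto
      show "\<exists>\<tau> v. mevals M s \<tau> v \<and> False # \<beta> = expand w \<tau>"
        using mevals_coin0[OF s(3) \<tau>(1)] \<tau>(2) s(1) expand.simps(3) by metis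
    qed
  next
    case (evals_coin1 \<pi> \<beta> u r)
    show ?case
    proof (rule mark[OF _ evals_coin1.prems])
      fix s assume "(Coin r, \<pi>) = fill_state T s" "fst s \<noteq> Mark"
      then obtain \<pi>' where s: "s = (Coin r, \<pi>')" "\<pi> = map (fill_frame T) \<pi>'" "r \<noteq> 2"
        by (cases s; cases "fst s") (auto split: if_splits)
      then obtain \<tau> v where \<tau>: "mevals M (Num 1, \<pi>') \<tau> v" "\<beta> = expand w \<tau>"
        using evals_coin1.IH[of "(Num 1, \<pi>')"] by auto
      show "\<exists>\<tau> v. mevals M s \<tau> v \<and> True # \<beta> = expand w \<tau>"
        using mevals_coin1[OF s(3) \<tau>(1)] \<tau>(2) s(1) expand.simps(3) by metis
    qed
  }
qed

lemma bij_betw_runs: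
  "bij_betw (\<lambda>x. expand w (fst x)) (runs M s) (dom (Eval (fill_state T s)))"
proof (rule bij_betw_imageI)
  show "inj_on (\<lambda>x. expand w (fst x)) (runs M s)"
    by (rule inj_onI) (auto simp: runs_def dest: mevals_inj)
  show "(\<lambda>x. expand w (fst x)) ` runs M s = dom (Eval (fill_state T s))"
  proof (intro equalityI subsetI)
    fix \<beta> assume "\<beta> \<in> (\<lambda>x. expand w (fst x)) ` runs M s"
    then obtain \<tau> v where "mevals M s \<tau> v" "\<beta> = expand w \<tau>" by (auto simp: runs_def)
    then show "\<beta> \<in> dom (Eval (fill_state T s))"
      using evals_fill by (fastforce simp flip: Eval_eq_Some_iff)
  next
    fix \<beta> assume "\<beta> \<in> dom (Eval (fill_state T s))"
    then obtain u where "evals (fill_state T s) \<beta> u" by (auto simp: Eval_eq_Some_iff)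
    then obtain \<tau> v where "mevals M s \<tau> v" "\<beta> = expand w \<tau>"
      using mevals_of_evals_fill by blast
    then have "(\<tau>, v) \<in> runs M s" "\<beta> = expand w (fst (\<tau>, v))" by (auto simp: runs_def)
    then show "\<beta> \<in> (\<lambda>x. expand w (fst x)) ` runs M s" by blast
  qed
qed

lemma weight_fill:
  "x \<in> runs M s \<Longrightarrow> weight (fill_state T s) (expand w (fst x)) = snd x * c ^ calls (fst x)"
  by (rule weight_eqI, rule evals_fill) (auto simp: runs_def)

text \<open>The index set and the values \<open>snd x\<close> depend on \<open>M\<close> and
  \<open>s\<close> alone; the thunk enters only through \<open>c\<close>. This makes the probability
  a power series in \<open>c\<close>.\<close>

lemma prob0_fill:
  assumes "fill_state T s = (N, [])"
  shows "prob0 N = (\<Sum>\<^sub>\<infinity>x\<in>runs M s. snd x * c ^ calls (fst x))"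
proof -
  have "prob0 N = infsum (weight (fill_state T s)) (dom (Eval (fill_state T s)))"
    unfolding prob0_def assms by (rule infsum_cong) (auto simp: weight_def)
  also have "\<dots> = (\<Sum>\<^sub>\<infinity>x\<in>runs M s. weight (fill_state T s) (expand w (fst x)))"
    by (rule infsum_reindex_bij_betw[OF bij_betw_runs, symmetric])
  also have "\<dots> = (\<Sum>\<^sub>\<infinity>x\<in>runs M s. snd x * c ^ calls (fst x))"
    by (rule infsum_cong) (rule weight_fill)
  finally show ?thesis .
qed

end

section \<open>Thunks: the argument itself, and coins in front of it\<close>

lemma closed_no_mark: "[] \<turnstile> M : \<sigma> \<Longrightarrow> 2 \<notin> coins M"
  using typing_coins by fastforce

text \<open>The untamed argument spends no coins; it gives the value of the power series at
  1.\<close>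

lemma thunk_refl: "[] \<turnstile> M : \<sigma> \<Longrightarrow> thunk M M [] 1"
  by unfold_locales (auto simp: closed_lift closed_subst dest: closed_no_mark)

text \<open>For the thunk \<open>M\<close> itself, with \<open>c = 1\<close>, the values of the runs
  are weights of the filled state, so both properties transfer along the bijection.\<close>

lemma runs_nonneg_summable:
  assumes M: "[] \<turnstile> M : \<sigma>" and s: "state_coins (fill_state M s) \<subseteq> {0..1}"
  shows "\<And>x. x \<in> runs M s \<Longrightarrow> 0 \<le> snd x" and "snd summable_on runs M s"
proof -
  interpret thunk M M "[]" 1 by (rule thunk_refl[OF M])
  show "0 \<le> snd x" if "x \<in> runs M s" for x
    using weight_fill[OF that] weight_nonneg[OF s, of "expand [] (fst x)"] by simp
  have "(\<lambda>x. weight (fill_state M s) (expand [] (fst x))) summable_on runs M s"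
    using summable_on_reindex_bij_betw[OF bij_betw_runs] weight_summable_on[OF s] by blast
  then show "snd summable_on runs M s"
    by (rule summable_on_cong[THEN iffD1, rotated]) (simp add: weight_fill)
qed

lemma Omega_closed: "[] \<turnstile> Omega \<sigma> : \<sigma>"
  unfolding Omega_def using ty_Var[of 0 "[\<sigma>]"] by (auto intro!: typing.intros)

text \<open>\<open>Omega\<close> and its unfolding form a cycle of deterministic steps, so no finite
  derivation starts at either state.\<close>

lemma Omega_diverges: "\<not> mevals M (Omega \<sigma>, \<pi>) \<tau> v"
proof -
  have st: "step (Omega \<sigma>, \<pi>) (Lam \<sigma> (Var 0), ArgF (Omega \<sigma>) # \<pi>)"
      "step (Lam \<sigma> (Var 0), ArgF (Omega \<sigma>) # \<pi>) (Omega \<sigma>, \<pi>)"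
    using step.intros(4)[of "Lam \<sigma> (Var 0)"] step.intros(8)[of \<sigma> "Var 0" "Omega \<sigma>"]
    by (simp_all add: Omega_def)
  have "s \<noteq> (Omega \<sigma>, \<pi>) \<and> s \<noteq> (Lam \<sigma> (Var 0), ArgF (Omega \<sigma>) # \<pi>)" if "mevals M s \<tau> v" for s
    using that
  proof (induction rule: mevals.induct)
    case (mevals_step s s' \<tau> v)
    then show ?case using st step_deterministic by blast
  qed (simp_all add: Omega_def)
  then show ?thesis by blast
qed

text \<open>The term that \<open>tamed r \<sigma> C\<close>, applied to \<open>N\<close>, passes on
  to \<open>C\<close>.\<close>

definition tame :: "rat \<Rightarrow> ty \<Rightarrow> tm \<Rightarrow> tm" where
  "tame r \<sigma> N = Ifz (Coin r) N (Omega \<sigma>)"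

lemma tame_closed:
  "0 \<le> r \<Longrightarrow> r \<le> 1 \<Longrightarrow> [] \<turnstile> N : \<sigma> \<Longrightarrow> [] \<turnstile> tame r \<sigma> N : \<sigma>"
  unfolding tame_def by (intro typing.intros Omega_closed)

lemma evals_tame:
  assumes "evals (N, \<pi>) \<alpha> v"
  shows "evals (tame r \<sigma> N, \<pi>) (False # \<alpha>) (v * real_of_rat r)"
  unfolding tame_def
  by (rule evals_step[OF step.intros(3)], rule evals_coin0, rule evals_step[OF step.intros(9)])
    (rule assms)

text \<open>The coin outcome 1 leads into \<open>Omega\<close>, which leaves only the outcome
  0.\<close>

lemma mevals_tame:
  assumes "mevals M (tame r \<sigma> N, \<pi>) \<tau> v" and "r \<noteq> 2"
  shows "\<exists>\<tau>' v'. \<tau> = Some False # \<tau>' \<and> v = v' * real_of_rat r \<and> mevals M (N, \<pi>) \<tau>' v'"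
proof -
  have "mevals M (Coin r, IfF N (Omega \<sigma>) # \<pi>) \<tau> v"
    using assms(1) by (simp add: tame_def mevals_step_iff[OF step.intros(3)])
  moreover have "\<not> mevals M (Num 1, IfF N (Omega \<sigma>) # \<pi>) \<tau>' v'" for \<tau>' v'
    using mevals_step_iff[OF step.intros(10)[of 0]] by (simp add: Omega_diverges)
  ultimately show ?thesis
    using assms(2) by (auto simp: mevals_Coin_iff mevals_step_iff[OF step.intros(9)]
        simp del: One_nat_def)
qed

text \<open>Biases multiply under nested taming, so two layers with \<open>p\<close> and
  \<open>q\<close> around \<open>M\<close> make a thunk of bias \<open>p * q\<close>.\<close>

lemma thunk_tame:
  assumes "thunk M T w c" and "[] \<turnstile> T : \<sigma>" and "0 \<le> r" "r \<le> 1"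
  shows "thunk M (tame r \<sigma> T) (False # w) (c * real_of_rat r)"
proof -
  interpret thunk M T w c by fact
  have closed: "[] \<turnstile> tame r \<sigma> T : \<sigma>" using assms by (intro tame_closed)
  have "r \<noteq> 2" using assms by auto
  show ?thesis
  proof unfold_locales
    show "evals (tame r \<sigma> T, \<pi>) ((False # w) @ \<alpha>) (v * (c * real_of_rat r))"
      if "evals (M, \<pi>) \<alpha> v" for \<pi> \<alpha> v
      using evals_tame[OF thunk_forward[OF that]] by (simp add: mult.assoc)
    show "\<exists>\<tau>' v'. \<tau> = map Some (False # w) @ \<tau>' \<and> v = v' * (c * real_of_rat r) \<and>
        mevals M (M, \<pi>) \<tau>' v'"
      if "mevals M (tame r \<sigma> T, \<pi>) \<tau> v" for \<pi> \<tau> v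
      using mevals_tame[OF that \<open>r \<noteq> 2\<close>] thunk_backward by fastforce
  qed (use closed closed_lift closed_subst closed_no_mark no_mark_M in auto)
qed

section \<open>Power series\<close>

text \<open>Fubini for the partition of \<open>D\<close> into level sets of \<open>n\<close>; since
  \<open>0 \<le> c \<le> 1\<close>, the family is dominated by \<open>V\<close>.\<close>

lemma sums_infsum_power:
  fixes V :: "'a \<Rightarrow> real"
  assumes nonneg: "\<And>x. x \<in> D \<Longrightarrow> 0 \<le> V x" and summable: "V summable_on D"
    and c: "0 \<le> c" "c \<le> 1"
  shows "(\<lambda>k. infsum V {x\<in>D. n x = k} * c ^ k) sums (\<Sum>\<^sub>\<infinity>x\<in>D. V x * c ^ n x)"
proof -
  let ?S = "Sigma UNIV (\<lambda>k. {x\<in>D. n x = k})" and ?f = "\<lambda>(k, x). V x * c ^ k"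
  have bij: "bij_betw (\<lambda>x. (n x, x)) D ?S"
    by (rule bij_betwI[where g = snd]) auto
  have "(\<lambda>x. V x * c ^ n x) summable_on D"
    by (rule summable_on_comparison_test[OF summable])
      (simp_all add: nonneg c mult_left_le power_le_one)
  then have f: "?f summable_on ?S"
    using summable_on_reindex_bij_betw[OF bij, of ?f] by simp
  have inner: "(\<Sum>\<^sub>\<infinity>x\<in>{x\<in>D. n x = k}. ?f (k, x)) = infsum V {x\<in>D. n x = k} * c ^ k" for k
    by (simp add: infsum_cmult_left')
  have "(\<Sum>\<^sub>\<infinity>k. infsum V {x\<in>D. n x = k} * c ^ k) = infsum ?f ?S"
    using infsum_Sigma_banach[OF f] by (simp only: inner)
  also have "\<dots> = (\<Sum>\<^sub>\<infinity>x\<in>D. V x * c ^ n x)"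
    using infsum_reindex_bij_betw[OF bij, of ?f] by simp
  finally have sum: "(\<Sum>\<^sub>\<infinity>k. infsum V {x\<in>D. n x = k} * c ^ k) = (\<Sum>\<^sub>\<infinity>x\<in>D. V x * c ^ n x)" .
  have "(\<lambda>k. infsum V {x\<in>D. n x = k} * c ^ k) summable_on UNIV"
    using summable_on_Sigma_banach[of "\<lambda>k x. V x * c ^ k", OF f] inner by simp
  from has_sum_imp_sums[OF has_sum_infsum[OF this]] show ?thesis unfolding sum .
qed

text \<open>Once the coefficients below \<open>m\<close> vanish, division by \<open>x j ^ m\<close>
  leaves a series that tends to \<open>d m\<close> at 0 and vanishes at \<open>x j\<close> for all
  large \<open>j\<close>.\<close>

lemma powser_coeffs_zero:
  fixes d :: "nat \<Rightarrow> real"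
  assumes d: "summable d" and x: "x \<longlonglongrightarrow> 0" "\<And>j. x j \<noteq> 0"
    and zero: "\<And>j::nat. (\<lambda>k. d k * x j ^ k) sums 0"
  shows "d m = 0"
proof (induction m rule: less_induct)
  case (less m)
  define f where "f y = (\<Sum>k. d (k + m) * y ^ k)" for y
  \<comment> \<open>Summability of \<open>d\<close> is convergence at 1, which gives convergence on
    the open unit disc; \<open>x j\<close> lies in it for large \<open>j\<close>.\<close>
  have sum1: "summable (\<lambda>k. d (k + m) * 1 ^ k)"
    using d by (simp add: summable_iff_shift)
  have sums: "(\<lambda>k. d (k + m) * y ^ k) sums f y" if "norm y < 1" for y
    unfolding f_def by (rule summable_sums, rule powser_inside[OF sum1]) (use that in simp)
  have "(f \<longlongrightarrow> d m) (at 0)"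
    using powser_limit_0[of 1 "\<lambda>k. d (k + m)" f] sums by simp
  then have "(\<lambda>j. f (x j)) \<longlonglongrightarrow> d m"
    by (rule filterlim_compose) (use x in \<open>auto simp: filterlim_at\<close>)
  moreover have "\<forall>\<^sub>F j in sequentially. f (x j) = 0"
  proof -
    have "\<forall>\<^sub>F j in sequentially. norm (x j) < 1"
      using order_tendstoD(2)[OF tendsto_norm_zero[OF x(1)], of 1] by simp
    then show ?thesis
    proof (eventually_elim)
      case (elim j)
      have "(\<lambda>k. d (k + m) * x j ^ (k + m)) sums 0"
        using sums_iff_shift[of "\<lambda>k. d k * x j ^ k" m 0] zero[of j] less by simp
      moreover have "(\<lambda>k. x j ^ m * (d (k + m) * x j ^ k)) sums (x j ^ m * f (x j))"
        by (intro sums_mult sums elim)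
      ultimately have "x j ^ m * f (x j) = 0"
        by (intro sums_unique2) (simp_all add: power_add mult_ac)
      then show ?case using x(2) by simp
    qed
  qed
  ultimately show ?case
    using LIMSEQ_unique[OF _ tendsto_eventually] by blast
qed

lemma powser_coeffs_unique:
  fixes a b :: "nat \<Rightarrow> real"
  assumes "summable a" "summable b" and "x \<longlonglongrightarrow> 0" "\<And>j. x j \<noteq> 0"
    and "\<And>j::nat. (\<lambda>k. a k * x j ^ k) sums f j" "\<And>j. (\<lambda>k. b k * x j ^ k) sums f j"
  shows "a = b"
proof
  fix m
  have "a m - b m = 0"
  proof (rule powser_coeffs_zero[OF summable_diff[OF assms(1,2)] assms(3,4)])
    show "(\<lambda>k. (a k - b k) * x j ^ k) sums 0" for j
      using sums_diff[OF assms(5)[of j] assms(6)[of j]] by (simp add: left_diff_distrib)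
  qed
  then show "a m = b m" by simp
qed

section \<open>Tamed contexts\<close>

lemma tamed_typing:
  assumes "[] \<turnstile> C : \<sigma> \<rightarrow> TNat" and "0 \<le> p" "p \<le> 1"
  shows "[] \<turnstile> tamed p \<sigma> C : \<sigma> \<rightarrow> TNat"
proof -
  have "[\<sigma>] \<turnstile> lift 0 C : \<sigma> \<rightarrow> TNat" "[\<sigma>] \<turnstile> Omega \<sigma> : \<sigma>"
    using typing_weaken[OF assms(1), of "[\<sigma>]"] typing_weaken[OF Omega_closed, of "[\<sigma>]"]
    by (simp_all add: closed_lift[OF assms(1)])
  then show ?thesis
    unfolding tamed_def using ty_Var[of 0 "[\<sigma>]"] assms(2,3)
    by (auto intro!: ty_Lam ty_App[of _ _ \<sigma>] ty_Ifz ty_Coin)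
qed

text \<open>An application step and a beta step lead from one state to the other; by call-by-name,
  \<open>N\<close> moves under the coin unevaluated.\<close>

lemma prob0_tamed:
  assumes C: "[] \<turnstile> C : \<sigma> \<rightarrow> TNat"
  shows "prob0 (App (tamed p \<sigma> C) N) = prob0 (App C (tame p \<sigma> N))"
proof -
  have beta: "step (tamed p \<sigma> C, [ArgF N]) (App C (tame p \<sigma> N), [])"
    using step.intros(8)[of \<sigma> "App C (Ifz (Coin p) (Var 0) (Omega \<sigma>))" N "[]"]
    by (simp add: tamed_def tame_def closed_lift[OF C] closed_subst[OF C]
        closed_subst[OF Omega_closed])
  have "weight (App (tamed p \<sigma> C) N, []) = weight (App C (tame p \<sigma> N), [])"
    using evals_step_iff[OF step.intros(2)] evals_step_iff[OF beta]
    by (intro ext weight_cong) simp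
  then show ?thesis by (simp add: prob0_eq_infsum)
qed

text \<open>
  The coefficient \<open>a n\<close> is the probability that \<open>App C M\<close> converges to 0 calling \<open>M\<close>
  exactly \<open>n\<close> times.
\<close>

lemma prob0_powser:
  assumes M: "[] \<turnstile> M : \<sigma>" and C: "[] \<turnstile> C : \<sigma> \<rightarrow> TNat"
  obtains a where "a sums prob0 (App C M)"
    and "\<And>p q. 0 \<le> p \<Longrightarrow> p \<le> 1 \<Longrightarrow> 0 \<le> q \<Longrightarrow> q \<le> 1 \<Longrightarrow>
      (\<lambda>k. a k * real_of_rat (p * q) ^ k) sums prob0 (App C (tame q \<sigma> (tame p \<sigma> M)))"
proof -
  let ?s = "(App C Mark, [])"
  define a where "a k = infsum snd {x \<in> runs M ?s. calls (fst x) = k}" for k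
  have fill: "fill_state T ?s = (App C T, [])" for T
    by (simp add: fill_trivial[OF closed_no_mark[OF C]])
  have "state_coins (fill_state M ?s) \<subseteq> {0..1}"
    unfolding fill state_coins_def using typing_coins[OF M] typing_coins[OF C] by simp
  note runs = runs_nonneg_summable[OF M this]
  \<comment> \<open>The coefficients are the same for every thunk of \<open>M\<close>.\<close>
  have sums: "(\<lambda>k. a k * c ^ k) sums prob0 (App C T)"
    if "thunk M T w c" "0 \<le> c" "c \<le> 1" for T w c
    unfolding thunk.prob0_fill[OF that(1) fill] a_def
    by (rule sums_infsum_power) (use runs that in auto)
  show ?thesis
  proof (rule that)
    show "a sums prob0 (App C M)" using sums[OF thunk_refl[OF M]] by simp
    fix p q :: rat assume pq: "0 \<le> p" "p \<le> 1" "0 \<le> q" "q \<le> 1"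
    have "thunk M (tame q \<sigma> (tame p \<sigma> M)) [False, False] (1 * real_of_rat p * real_of_rat q)"
      using pq M by (intro thunk_tame thunk_refl[OF M] tame_closed)
    moreover have "0 \<le> real_of_rat (p * q)" "real_of_rat (p * q) \<le> 1"
      using pq by (simp_all add: mult_le_one)
    ultimately show "(\<lambda>k. a k * real_of_rat (p * q) ^ k) sums prob0 (App C (tame q \<sigma> (tame p \<sigma> M)))"
      using sums by (simp add: of_rat_mult)
  qed
qed

text \<open>Both probabilities lie in the unit interval, so the real supremum is over a bounded set
  and does bound its members.\<close>

lemma prob0_le_obs_dist:
  assumes "M \<in> closed_tms \<sigma>" "M' \<in> closed_tms \<sigma>" "C \<in> closed_tms (\<sigma> \<rightarrow> TNat)"
    and "0 \<le> p" "p \<le> 1"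
  shows "\<bar>prob0 (App (tamed p \<sigma> C) M) - prob0 (App (tamed p \<sigma> C) M')\<bar> \<le> obs_dist p \<sigma> M M'"
  unfolding obs_dist_def
proof (rule cSUP_upper[OF assms(3)], rule bdd_aboveI2[where M = 1])
  fix C assume "C \<in> closed_tms (\<sigma> \<rightarrow> TNat)"
  then have "coins (App (tamed p \<sigma> C) N) \<subseteq> {0..1}" if "N \<in> closed_tms \<sigma>" for N
    using that tamed_typing assms(4,5) unfolding closed_tms_def
    by (intro typing_coins[of "[]" _ TNat]) (auto intro: ty_App)
  then show "\<bar>prob0 (App (tamed p \<sigma> C) M) - prob0 (App (tamed p \<sigma> C) M')\<bar> \<le> 1"
    using prob0_nonneg prob0_le_1 assms(1,2) by (smt (verit))
qed

theorem theorem4p2: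
  fixes p :: rat and \<sigma> :: ty and M M' :: tm
  assumes "0 < p" and "p \<le> 1"
    and "M \<in> closed_tms \<sigma>" and "M' \<in> closed_tms \<sigma>"
    and "obs_dist p \<sigma> M M' = 0"
  shows "obs_equiv \<sigma> M M'"
  unfolding obs_equiv_def
proof
  fix C assume "C \<in> closed_tms (\<sigma> \<rightarrow> TNat)"
  then have C: "[] \<turnstile> C : \<sigma> \<rightarrow> TNat" by (simp add: closed_tms_def)
  have M: "[] \<turnstile> M : \<sigma>" and M': "[] \<turnstile> M' : \<sigma>" using assms by (simp_all add: closed_tms_def)
  obtain a where a: "a sums prob0 (App C M)" "\<And>p q. 0 \<le> p \<Longrightarrow> p \<le> 1 \<Longrightarrow> 0 \<le> q \<Longrightarrow> q \<le> 1 \<Longrightarrow>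
      (\<lambda>k. a k * real_of_rat (p * q) ^ k) sums prob0 (App C (tame q \<sigma> (tame p \<sigma> M)))"
    by (rule prob0_powser[OF M C]) (rule that)
  obtain b where b: "b sums prob0 (App C M')" "\<And>p q. 0 \<le> p \<Longrightarrow> p \<le> 1 \<Longrightarrow> 0 \<le> q \<Longrightarrow> q \<le> 1 \<Longrightarrow>
      (\<lambda>k. b k * real_of_rat (p * q) ^ k) sums prob0 (App C (tame q \<sigma> (tame p \<sigma> M')))"
    by (rule prob0_powser[OF M' C]) (rule that)
  \<comment> \<open>The distance at \<open>p\<close> is applied to the context
    \<open>tamed q \<sigma> C\<close>; resolving both tamings wraps the argument first with
    \<open>p\<close>, then with \<open>q\<close>.\<close>
  have eq: "prob0 (App C (tame q \<sigma> (tame p \<sigma> M))) = prob0 (App C (tame q \<sigma> (tame p \<sigma> M')))"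
    if "0 \<le> q" "q \<le> 1" for q
  proof -
    have "[] \<turnstile> tamed q \<sigma> C : \<sigma> \<rightarrow> TNat" using tamed_typing[OF C that] .
    then show ?thesis
      using prob0_le_obs_dist[OF assms(3,4), of "tamed q \<sigma> C" p] assms(1,2,5)
      by (simp add: closed_tms_def prob0_tamed prob0_tamed[OF C])
  qed
  \<comment> \<open>Coin parameters must be rational and in the unit interval; these are also
    nonzero and tend to 0.\<close>
  define q :: "nat \<Rightarrow> rat" where "q j = 1 / of_nat (Suc j)" for j
  have q: "0 < q j" "q j \<le> 1" for j by (simp_all add: q_def)
  have "a = b"
  proof (rule powser_coeffs_unique)
    show "summable a" "summable b" using a(1) b(1) by (auto simp: sums_iff)
    have "(\<lambda>j. real_of_rat p * inverse (real (Suc j))) \<longlonglongrightarrow> real_of_rat p * 0"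
      by (intro tendsto_intros LIMSEQ_inverse_real_of_nat)
    then show "(\<lambda>j. real_of_rat (p * q j)) \<longlonglongrightarrow> 0"
      by (simp add: q_def of_rat_mult of_rat_divide inverse_eq_divide del: of_nat_Suc)
    show "real_of_rat (p * q j) \<noteq> 0" for j using q[of j] assms(1) by simp
    show "(\<lambda>k. a k * real_of_rat (p * q j) ^ k) sums prob0 (App C (tame (q j) \<sigma> (tame p \<sigma> M)))" for j
      using a(2)[of p "q j"] q[of j] assms(1,2) by simp
    show "(\<lambda>k. b k * real_of_rat (p * q j) ^ k) sums prob0 (App C (tame (q j) \<sigma> (tame p \<sigma> M)))" for j
      using b(2)[of p "q j"] q[of j] assms(1,2) eq[of "q j"] by simp
  qed
  then show "prob0 (App C M) = prob0 (App C M')"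
    using a(1) b(1) sums_unique2 by blast
qed

end
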